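(* A graph $G$ is well-dominated with $\gamma(G)=2$ if and only if: (i) $\overline{G}$ is a triangle-free graph without isolated vertices; and (ii) for every two triangles $T,T'$ of $G$ such that $T\cup T'$ induces a subgraph isomorphic to $\overline{C_6}$, the set $T\cup (V(G)\setminus N[T'])$ is not a dominating set of $G$.
   Context: A graph is well-dominated if all its inclusion-minimal dominating sets have the same size; $\gamma$ is the domination number. A triangle is a set of three pairwise adjacent vertices. $\overline{C_6}$ is the complement of the 6-vertex cycle. For $X\subseteq V(G)$, $N[X]$ is the union of the closed neighborhoods of vertices of $X$. *)

theory Defs
  imports "Graph_Theory.Pair_Digraph" "Graph_Theory.Digraph_Isomorphism"
begin

text \<open>
  Finite simple graphs are symmetric loop-free finite digraphs without parallel arcs
  (locale \<^locale>\<open>pair_graph\<close>): an edge joining u and v is the pair of arcs (u,v) and (v,u).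
\<close>

definition complement_graph :: "'a pair_pre_digraph \<Rightarrow> 'a pair_pre_digraph" where
  "complement_graph G = \<lparr> pverts = pverts G,
     parcs = {(u, v). u \<in> pverts G \<and> v \<in> pverts G \<and> u \<noteq> v \<and> (u, v) \<notin> parcs G} \<rparr>"

text \<open>For n at least 3 this is the n-vertex cycle.\<close>

definition cycle_graph :: "nat \<Rightarrow> nat pair_pre_digraph" where
  "cycle_graph n = \<lparr> pverts = {..<n},
     parcs = {(i, j). i < n \<and> j < n \<and> (j = (i + 1) mod n \<or> i = (j + 1) mod n)} \<rparr>"

definition closed_neighborhood :: "'a pair_pre_digraph \<Rightarrow> 'a \<Rightarrow> 'a set" where
  "closed_neighborhood G v = insert v {u. (v, u) \<in> parcs G}"

definition closed_neighborhood_set :: "'a pair_pre_digraph \<Rightarrow> 'a set \<Rightarrow> 'a set" where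
  "closed_neighborhood_set G X = (\<Union>v\<in>X. closed_neighborhood G v)"

definition dominating_set :: "'a pair_pre_digraph \<Rightarrow> 'a set \<Rightarrow> bool" where
  "dominating_set G D \<longleftrightarrow>
     D \<subseteq> pverts G \<and> (\<forall>v \<in> pverts G - D. \<exists>u \<in> D. (u, v) \<in> parcs G)"

definition minimal_dominating_set :: "'a pair_pre_digraph \<Rightarrow> 'a set \<Rightarrow> bool" where
  "minimal_dominating_set G D \<longleftrightarrow>
     dominating_set G D \<and> (\<forall>D'. D' \<subset> D \<longrightarrow> \<not> dominating_set G D')"

definition well_dominated :: "'a pair_pre_digraph \<Rightarrow> bool" where
  "well_dominated G \<longleftrightarrow>
     (\<forall>D D'. minimal_dominating_set G D \<and> minimal_dominating_set G D' \<longrightarrow> card D = card D')"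

definition domination_number :: "'a pair_pre_digraph \<Rightarrow> nat" where
  "domination_number G = Min (card ` {D. dominating_set G D})"

definition is_triangle :: "'a pair_pre_digraph \<Rightarrow> 'a set \<Rightarrow> bool" where
  "is_triangle G T \<longleftrightarrow>
     T \<subseteq> pverts G \<and> card T = 3 \<and> (\<forall>u\<in>T. \<forall>v\<in>T. u \<noteq> v \<longrightarrow> (u, v) \<in> parcs G)"

definition triangle_free :: "'a pair_pre_digraph \<Rightarrow> bool" where
  "triangle_free G \<longleftrightarrow> (\<nexists>T. is_triangle G T)"

definition isolated_vertex :: "'a pair_pre_digraph \<Rightarrow> 'a \<Rightarrow> bool" where
  "isolated_vertex G v \<longleftrightarrow> v \<in> pverts G \<and> (\<nexists>u. (v, u) \<in> parcs G)"

lemma pair_graph_complement_graph: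
  assumes "pair_graph G"
  shows "pair_graph (complement_graph G)"
proof -
  interpret pair_graph G by (rule assms)
  have "finite (parcs (complement_graph G))"
    by (rule finite_subset[of _ "pverts G \<times> pverts G"]) (auto simp: complement_graph_def)
  moreover have "sym (parcs G)"
    using pair_sym_arcs by (simp add: symmetric_def)
  ultimately show ?thesis
    by unfold_locales (auto simp: complement_graph_def symmetric_def sym_def)
qed

lemma pair_graph_cycle_graph:
  assumes "n \<ge> 2"
  shows "pair_graph (cycle_graph n)"
proof -
  have "finite (parcs (cycle_graph n))"
    by (rule finite_subset[of _ "{..<n} \<times> {..<n}"]) (auto simp: cycle_graph_def)
  moreover have "Suc i mod n \<noteq> i" if "i < n" for i
    using assms that by (cases "Suc i = n") auto
  ultimately show ?thesis
    by unfold_locales (fastforce simp: cycle_graph_def symmetric_def sym_def)+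
qed

end

theory Submission
  imports Defs
begin

text \<open>
  Both directions rest on private neighbours: a vertex d of a dominating set D is indispensable
  iff some vertex p satisfies N[p] \<inter> D = {d}.

  If the three vertices of a set T have private neighbours with respect to a dominating set
  D \<supseteq> T, then every minimal dominating subset of D contains T and so has at least three elements.
  This applies to an independent T (a triangle of the complement) with
  D = T \<union> (V \<setminus> N[T]), where each vertex is its own private neighbour, and to a pair T, T' violating
  (ii) with D = T \<union> (V \<setminus> N[T']), where the private neighbours are the partners in the perfect
  matching between the two triangles of the complement of the 6-cycle.

  Conversely, let D be a minimal dominating set with three distinct vertices a, b, c, and let
  a', b', c' be private neighbours of them. Since G has no three independent vertices, none of the
  private neighbours lies in D and both {a, b, c} and {a', b', c'} are triangles; they
  induce the complement of the 6-cycle, and D \<subseteq> T \<union> (V \<setminus> N[T']), contradicting (ii).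
\<close>

section \<open>Isomorphism with induced subgraphs, and an explicit form of the complement of the
  6-cycle\<close>

text \<open>A \<open>digraph_iso\<close> also carries maps for arcs, tails and heads. On both sides
  arcs are pairs with tail \<open>fst\<close> and head \<open>snd\<close>, so the vertex map
  determines the rest.\<close>

lemma digraph_iso_induce_subgraph_iff:
  assumes "pair_wf_digraph G"
  shows "digraph_iso (with_proj G \<restriction> S) (with_proj H) \<longleftrightarrow>
    (\<exists>f. bij_betw f S (pverts H) \<and> parcs H = map_prod f f ` (parcs G \<inter> S \<times> S))"
proof -
  interpret pair_wf_digraph G by (rule assms)
  have arcs: "arcs (with_proj G \<restriction> S) = parcs G \<inter> S \<times> S"
    by auto
  show ?thesis
  proof
    assume "digraph_iso (with_proj G \<restriction> S) (with_proj H)"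
    then obtain h where iso: "pre_digraph.digraph_isomorphism (with_proj G \<restriction> S) h"
      and H: "with_proj H = app_iso h (with_proj G \<restriction> S)"
      by (auto simp: digraph_iso_def)
    have tail: "iso_tail h = fst" and head: "iso_head h = snd"
      using arg_cong[OF H, of tail] arg_cong[OF H, of head] by simp_all
    have "iso_arcs h e = map_prod (iso_verts h) (iso_verts h) e" if "e \<in> parcs G \<inter> S \<times> S" for e
      using iso that unfolding pre_digraph.digraph_isomorphism_def arcs tail head
      by (intro prod_eqI) auto
    then have "parcs H = map_prod (iso_verts h) (iso_verts h) ` (parcs G \<inter> S \<times> S)"
      using arg_cong[OF H, of arcs] unfolding arcs_app_iso arcs by simp
    moreover have "bij_betw (iso_verts h) S (pverts H)"
      using iso arg_cong[OF H, of verts]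
      by (simp add: pre_digraph.digraph_isomorphism_def bij_betw_def)
    ultimately show "\<exists>f. bij_betw f S (pverts H) \<and> parcs H = map_prod f f ` (parcs G \<inter> S \<times> S)"
      by blast
  next
    assume "\<exists>f. bij_betw f S (pverts H) \<and> parcs H = map_prod f f ` (parcs G \<inter> S \<times> S)"
    then obtain f where f: "bij_betw f S (pverts H)"
      and H: "parcs H = map_prod f f ` (parcs G \<inter> S \<times> S)"
      by blast
    let ?h = "\<lparr>iso_verts = f, iso_arcs = map_prod f f, iso_head = snd, iso_tail = fst\<rparr>"
    have inj: "inj_on f S"
      using f by (simp add: bij_betw_def)
    then have "inj_on (map_prod f f) (parcs G \<inter> S \<times> S)"
      by (rule inj_on_subset[OF map_prod_inj_on[OF _ inj]]) simp
    then have "pre_digraph.digraph_isomorphism (with_proj G \<restriction> S) ?h"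
      using inj wellformed_induce_subgraph[of S] unfolding pre_digraph.digraph_isomorphism_def arcs
      by auto
    moreover have "with_proj H = app_iso ?h (with_proj G \<restriction> S)"
      unfolding app_iso_def arcs using f H by (simp add: with_proj_def bij_betw_def)
    ultimately show "digraph_iso (with_proj G \<restriction> S) (with_proj H)"
      by (auto simp: digraph_iso_def)
  qed
qed

text \<open>The list shows the prism: even and odd vertices form the two triangles, and the opposite
  vertices \<open>i\<close>, \<open>i + 3\<close> are matched.\<close>

lemma parcs_complement_cycle_graph_6:
  "parcs (complement_graph (cycle_graph 6)) =
    {(0,2),(0,3),(0,4),(1,3),(1,4),(1,5),(2,0),(2,4),(2,5),
     (3,0),(3,1),(3,5),(4,0),(4,1),(4,2),(5,1),(5,2),(5,3)}" (is "?L = ?R")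
proof -
  have six: "{..<6} = {0, 1, 2, 3, 4, 5::nat}"
    by auto
  \<comment> \<open>Filtering an explicit finite product makes the set computable by
    \<open>code_simp\<close>.\<close>
  have "?L = Set.filter (\<lambda>(i, j). i \<noteq> j \<and> j \<noteq> (i + 1) mod 6 \<and> i \<noteq> (j + 1) mod 6) ({..<6} \<times> {..<6})"
    by (auto simp: complement_graph_def cycle_graph_def)
  also have "\<dots> = ?R"
    unfolding six by code_simp
  finally show ?thesis .
qed

text \<open>This 3-regularity supplies the degree count behind
  \<open>prism_matching\<close>.\<close>

lemma card_neighbors_complement_cycle_graph_6:
  assumes "i < 6"
  shows "card {j. (i, j) \<in> parcs (complement_graph (cycle_graph 6))} = 3"
proof -
  have "{j. (i, j) \<in> A} = snd ` Set.filter (\<lambda>e. fst e = i) A" for A :: "(nat \<times> nat) set"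
    by force
  moreover have "\<forall>i\<in>{0, 1, 2, 3, 4, 5::nat}. card (snd ` Set.filter (\<lambda>e. fst e = i)
    {(0,2),(0,3),(0,4),(1,3),(1,4),(1,5),(2,0),(2,4),(2,5),
     (3,0),(3,1),(3,5),(4,0),(4,1),(4,2),(5,1),(5,2),(5,3::nat)}) = (3::nat)"
    by code_simp
  moreover have "i \<in> {0, 1, 2, 3, 4, 5}"
    using assms by auto
  ultimately show ?thesis
    unfolding parcs_complement_cycle_graph_6 by metis
qed

section \<open>Dominating sets and private neighbours\<close>

context pair_graph
begin

lemma arc_commute: "(u, v) \<in> parcs G \<longleftrightarrow> (v, u) \<in> parcs G"
  using pair_sym_arcs by (auto simp: symmetric_def sym_def)

lemma arc_sym: "(u, v) \<in> parcs G \<Longrightarrow> (v, u) \<in> parcs G"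
  and not_arc_sym: "(u, v) \<notin> parcs G \<Longrightarrow> (v, u) \<notin> parcs G"
  using arc_commute by blast+

lemma not_loop: "(u, u) \<notin> parcs G"
  using pair_no_loops[of "(u, u)"] by auto

lemma dominating_set_iff:
  "dominating_set G D \<longleftrightarrow> D \<subseteq> pverts G \<and> (\<forall>v\<in>pverts G. closed_neighborhood G v \<inter> D \<noteq> {})"
  unfolding dominating_set_def closed_neighborhood_def using arc_commute by blast

lemma dominating_set_mono:
  "dominating_set G D \<Longrightarrow> D \<subseteq> D' \<Longrightarrow> D' \<subseteq> pverts G \<Longrightarrow> dominating_set G D'"
  unfolding dominating_set_iff by blast

lemma finite_dominating_sets: "finite {D. dominating_set G D}"
  by (rule finite_subset[of _ "Pow (pverts G)"]) (auto simp: dominating_set_def pair_finite_verts)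

lemma minimal_dominating_subset:
  assumes "dominating_set G D"
  obtains D' where "minimal_dominating_set G D'" "D' \<subseteq> D"
proof -
  let ?F = "{D'. dominating_set G D' \<and> D' \<subseteq> D}"
  have "finite ?F"
    using finite_dominating_sets by simp
  moreover have "?F \<noteq> {}"
    using assms by blast
  ultimately obtain D' where "D' \<in> ?F" "\<forall>X\<in>?F. X \<subseteq> D' \<longrightarrow> D' = X"
    by (meson finite_has_minimal)
  then have "minimal_dominating_set G D'" "D' \<subseteq> D"
    unfolding minimal_dominating_set_def by auto
  then show thesis
    by (rule that)
qed

lemma private_neighbor:
  assumes "minimal_dominating_set G D" "d \<in> D"
  obtains p where "p \<in> pverts G" "closed_neighborhood G p \<inter> D = {d}"
proof -
  have "\<not> dominating_set G (D - {d})" and D: "dominating_set G D"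
    using assms unfolding minimal_dominating_set_def by auto
  \<comment> \<open>A vertex that \<open>D - {d}\<close> fails to dominate is the private neighbour:
    \<open>D\<close> does meet its closed neighbourhood, hence only in \<open>d\<close>.\<close>
  then obtain p where "p \<in> pverts G" "closed_neighborhood G p \<inter> (D - {d}) = {}"
    unfolding dominating_set_iff by blast
  with D show thesis
    using that[of p] unfolding dominating_set_iff by blast
qed

text \<open>Any dominating subset of \<open>D\<close> must meet the closed neighbourhood of
  \<open>p\<close>, and \<open>t\<close> is the only element of \<open>D\<close> available
  there.\<close>

lemma minimal_dominating_set_supset_if_private_neighbors:
  assumes "dominating_set G D"
    and "\<And>t. t \<in> T \<Longrightarrow> \<exists>p\<in>pverts G. closed_neighborhood G p \<inter> D = {t}"
  obtains D' where "minimal_dominating_set G D'" "T \<subseteq> D'"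
proof -
  obtain D' where D': "minimal_dominating_set G D'" "D' \<subseteq> D"
    using assms(1) by (rule minimal_dominating_subset)
  have "T \<subseteq> D'"
  proof
    fix t assume "t \<in> T"
    then obtain p where p: "p \<in> pverts G" "closed_neighborhood G p \<inter> D = {t}"
      using assms(2) by blast
    then have "closed_neighborhood G p \<inter> D' \<noteq> {}"
      using D'(1) by (simp add: minimal_dominating_set_def dominating_set_iff)
    then obtain x where x: "x \<in> closed_neighborhood G p" "x \<in> D'"
      by blast
    with D'(2) have "x \<in> closed_neighborhood G p \<inter> D"
      by blast
    with p x show "t \<in> D'"
      by simp
  qed
  with D'(1) show thesis
    by (rule that)
qed

lemma finite_dominating_set: "dominating_set G D \<Longrightarrow> finite D"
  using pair_finite_verts finite_subset unfolding dominating_set_def by blast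

text \<open>A dominating set of least cardinality is also inclusion-minimal, since a proper subset
  would be smaller.\<close>

lemma domination_number_attained:
  obtains D where "minimal_dominating_set G D" "card D = domination_number G"
proof -
  have fin: "finite (card ` {D. dominating_set G D})"
    using finite_dominating_sets by blast
  have "dominating_set G (pverts G)"
    by (simp add: dominating_set_def)
  then have "domination_number G \<in> card ` {D. dominating_set G D}"
    unfolding domination_number_def using fin by (intro Min_in) auto
  then obtain D where D: "dominating_set G D" "card D = domination_number G"
    by auto
  have "\<not> dominating_set G D'" if "D' \<subset> D" for D'
  proof
    assume "dominating_set G D'"
    then have "domination_number G \<le> card D'"
      unfolding domination_number_def using fin by (intro Min_le) auto
    moreover have "card D' < card D"
      using psubset_card_mono[OF finite_dominating_set[OF D(1)] that] .
    ultimately show False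
      using D(2) by simp
  qed
  with D that show thesis
    unfolding minimal_dominating_set_def by blast
qed

lemma well_dominated_with_number_iff:
  "well_dominated G \<and> domination_number G = k \<longleftrightarrow> (\<forall>D. minimal_dominating_set G D \<longrightarrow> card D = k)"
  unfolding well_dominated_def using domination_number_attained by metis

section \<open>Conditions on the complement, read in the graph itself\<close>

lemma triangle_complement_graph_iff:
  "is_triangle (complement_graph G) T \<longleftrightarrow>
    T \<subseteq> pverts G \<and> card T = 3 \<and> (\<forall>u\<in>T. \<forall>v\<in>T. (u, v) \<notin> parcs G)"
  unfolding is_triangle_def complement_graph_def
  by (auto simp: not_loop) (metis not_loop)

lemma isolated_vertex_complement_graph_iff:
  "isolated_vertex (complement_graph G) v \<longleftrightarrow> v \<in> pverts G \<and> dominating_set G {v}"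
  unfolding isolated_vertex_def complement_graph_def dominating_set_def by auto

section \<open>The complement of the 6-cycle as two triangles joined by a perfect matching\<close>

text \<open>By counting degrees: each vertex has three neighbours in the union, two of them in its
  own triangle, so exactly one in the other triangle.\<close>

lemma prism_matching:
  assumes T: "is_triangle G T" and T': "is_triangle G T'"
    and iso: "digraph_iso (with_proj G \<restriction> (T \<union> T')) (with_proj (complement_graph (cycle_graph 6)))"
    and "t \<in> T"
  obtains t' where "t' \<in> T'" "closed_neighborhood G t' \<inter> T = {t}"
proof -
  let ?C = "complement_graph (cycle_graph 6)" and ?S = "T \<union> T'"
  have fin: "finite T" "finite T'"
    using T T' by (auto simp: is_triangle_def intro: card_ge_0_finite)
  obtain f where f: "bij_betw f ?S (pverts ?C)"
    and arcs: "parcs ?C = map_prod f f ` (parcs G \<inter> ?S \<times> ?S)"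
    using iso unfolding digraph_iso_induce_subgraph_iff[OF pair_wf_digraph_axioms] by blast
  have C: "pverts ?C = {..<6}"
    by (simp add: complement_graph_def cycle_graph_def)
  have "card ?S = 6"
    using bij_betw_same_card[OF f] C by simp
  \<comment> \<open>Two triples can cover six vertices only if they are disjoint.\<close>
  then have disj: "T \<inter> T' = {}"
    using T T' fin card_Un_Int[of T T'] by (simp add: is_triangle_def)
  let ?N = "\<lambda>v. {u. (v, u) \<in> parcs G}"
  have deg: "card (?N v \<inter> ?S) = 3" if v: "v \<in> ?S" for v
  proof -
    have "f v < 6"
      using f C v by (auto simp: bij_betw_def)
    moreover have "{j. (f v, j) \<in> parcs ?C} = f ` (?N v \<inter> ?S)"
      unfolding arcs using f v by (auto simp: bij_betw_def inj_on_def)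
    moreover have "inj_on f (?N v \<inter> ?S)"
      using f by (auto simp: bij_betw_def intro: inj_on_subset)
    ultimately show ?thesis
      using card_neighbors_complement_cycle_graph_6[of "f v"] by (simp add: card_image)
  qed
  \<comment> \<open>Stated for \<open>X\<close> and \<open>Y\<close> so that it applies from
    \<open>T\<close> to \<open>T'\<close> and back.\<close>
  have one: "card (?N v \<inter> Y) = 1"
    if "is_triangle G X" "finite X" "finite Y" "X \<inter> Y = {}" "X \<union> Y = ?S" "v \<in> X" for v X Y
  proof -
    have "?N v \<inter> X = X - {v}"
      using that not_loop by (auto simp: is_triangle_def)
    then have "card (?N v \<inter> X) = 2"
      using that by (simp add: is_triangle_def)
    moreover have "card (?N v \<inter> ?S) = card (?N v \<inter> X) + card (?N v \<inter> Y)"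
      using that by (subst card_Un_disjoint[symmetric]) (auto intro!: arg_cong[of _ _ card])
    ultimately show ?thesis
      using deg[of v] that by auto
  qed
  have "card (?N t \<inter> T') = 1"
    using T fin disj \<open>t \<in> T\<close> by (intro one) auto
  then obtain t' where "?N t \<inter> T' = {t'}"
    by (auto simp: card_1_singleton_iff)
  then have t': "t' \<in> T'" "t \<in> ?N t'"
    using arc_commute by auto
  then have "card (?N t' \<inter> T) = 1"
    using T' fin disj by (intro one[of T']) auto
  moreover have "t \<in> ?N t' \<inter> T"
    using t' \<open>t \<in> T\<close> by simp
  ultimately have "?N t' \<inter> T = {t}"
    by (metis card_1_singletonE singletonD)
  then have "closed_neighborhood G t' \<inter> T = {t}"
    using t' disj by (auto simp: closed_neighborhood_def)
  with t' that show thesis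
    by blast
qed

lemma prism_iso:
  assumes dist: "distinct [a, b, c, a', b', c']"
    and edges: "(a, b) \<in> parcs G" "(a, c) \<in> parcs G" "(b, c) \<in> parcs G"
      "(a', b') \<in> parcs G" "(a', c') \<in> parcs G" "(b', c') \<in> parcs G"
      "(a, a') \<in> parcs G" "(b, b') \<in> parcs G" "(c, c') \<in> parcs G"
    and nonedges: "(a, b') \<notin> parcs G" "(a, c') \<notin> parcs G" "(b, a') \<notin> parcs G"
      "(b, c') \<notin> parcs G" "(c, a') \<notin> parcs G" "(c, b') \<notin> parcs G"
  shows "digraph_iso (with_proj G \<restriction> ({a, b, c} \<union> {a', b', c'}))
    (with_proj (complement_graph (cycle_graph 6)))"
proof -
  let ?C = "complement_graph (cycle_graph 6)" and ?S = "{a, b, c} \<union> {a', b', c'}"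
  \<comment> \<open>One triangle goes to the even vertices and each partner to the opposite odd
    vertex, that is, \<open>i + 3\<close> modulo 6.\<close>
  define f where "f = (\<lambda>x. if x = a then 0 else if x = b then 2 else if x = c then 4
    else if x = a' then 3 else if x = b' then 5 else 1 :: nat)"
  have f: "f a = 0" "f b = 2" "f c = 4" "f a' = 3" "f b' = 5" "f c' = 1"
    using dist by (auto simp: f_def)
  have arcs: "parcs G \<inter> ?S \<times> ?S =
    {(a,b),(a,a'),(a,c),(c',a'),(c',c),(c',b'),(b,a),(b,c),(b,b'),
     (a',a),(a',c'),(a',b'),(c,a),(c,c'),(c,b),(b',c'),(b',b),(b',a')}"
    using edges nonedges edges[THEN arc_sym] nonedges[THEN not_arc_sym] not_loop by auto
  have "pverts ?C = {0, 1, 2, 3, 4, 5}"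
    by (auto simp: complement_graph_def cycle_graph_def)
  then have "bij_betw f ?S (pverts ?C)"
    using f by (auto simp: bij_betw_def inj_on_def)
  moreover have "parcs ?C = map_prod f f ` (parcs G \<inter> ?S \<times> ?S)"
    unfolding arcs parcs_complement_cycle_graph_6 by (simp add: f)
  ultimately show ?thesis
    unfolding digraph_iso_induce_subgraph_iff[OF pair_wf_digraph_axioms] by blast
qed

section \<open>The upper bound on minimal dominating sets\<close>

lemma no_independent_triple:
  assumes tf: "triangle_free (complement_graph G)"
    and "x \<in> pverts G" "y \<in> pverts G" "z \<in> pverts G" "x \<noteq> y" "x \<noteq> z" "y \<noteq> z"
    and "(x, y) \<notin> parcs G" "(x, z) \<notin> parcs G"
  shows "(y, z) \<in> parcs G"
proof (rule ccontr)
  assume "(y, z) \<notin> parcs G"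
  moreover have "(y, x) \<notin> parcs G" "(z, x) \<notin> parcs G" "(z, y) \<notin> parcs G"
    using assms calculation by (auto dest: arc_sym)
  ultimately have "is_triangle (complement_graph G) {x, y, z}"
    unfolding triangle_complement_graph_iff using assms by (simp add: not_loop)
  with tf show False
    by (auto simp: triangle_free_def)
qed

lemma card_minimal_dominating_set_le_2:
  assumes tf: "triangle_free (complement_graph G)"
    and prism: "\<And>T T'. is_triangle G T \<Longrightarrow> is_triangle G T' \<Longrightarrow>
      digraph_iso (with_proj G \<restriction> (T \<union> T')) (with_proj (complement_graph (cycle_graph 6))) \<Longrightarrow>
      \<not> dominating_set G (T \<union> (pverts G - closed_neighborhood_set G T'))"
    and D: "minimal_dominating_set G D"
  shows "card D \<le> 2"
proof (rule ccontr)
  assume "\<not> card D \<le> 2"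
  then have "3 \<le> card D"
    by simp
  then obtain T where "T \<subseteq> D" "card T = 3"
    by (rule obtain_subset_with_card_n)
  then obtain a b c where T: "T = {a, b, c}" "a \<noteq> b" "a \<noteq> c" "b \<noteq> c" and
    abc: "a \<in> D" "b \<in> D" "c \<in> D"
    by (auto simp: card_3_iff)
  have dom: "dominating_set G D" and DV: "D \<subseteq> pverts G"
    using D by (auto simp: minimal_dominating_set_def dominating_set_def)
  obtain p where p: "\<And>d. d \<in> D \<Longrightarrow> p d \<in> pverts G"
    "\<And>d. d \<in> D \<Longrightarrow> closed_neighborhood G (p d) \<inter> D = {d}"
  proof -
    have "\<forall>d\<in>D. \<exists>p. p \<in> pverts G \<and> closed_neighborhood G p \<inter> D = {d}"
      by (meson private_neighbor[OF D])
    then show thesis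
      using that by (auto dest!: bchoice)
  qed
  have nonadj: "(p d, x) \<notin> parcs G" "(x, p d) \<notin> parcs G" "p d \<noteq> x"
    if "d \<in> D" "x \<in> D" "x \<noteq> d" for d x
    using p(2)[OF that(1)] that arc_commute[of x "p d"] by (auto simp: closed_neighborhood_def)
  \<comment> \<open>\<open>p d\<close> is a common non-neighbour of \<open>x\<close> and
    \<open>y\<close>, so independence of the triple would follow if these were not adjacent.\<close>
  have clique: "(x, y) \<in> parcs G" if "d \<in> D" "x \<in> D" "y \<in> D" "x \<noteq> d" "y \<noteq> d" "x \<noteq> y" for d x y
    by (rule no_independent_triple[OF tf, of "p d"])
      (use nonadj[of d x] nonadj[of d y] p(1)[of d] DV that in auto)
  have D_clique: "(x, y) \<in> parcs G" if "x \<in> D" "y \<in> D" "x \<noteq> y" for x y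
  proof -
    obtain d where "d \<in> T" "d \<noteq> x" "d \<noteq> y"
      using T by blast
    then show ?thesis
      using clique[of d x y] that \<open>T \<subseteq> D\<close> by blast
  qed
  \<comment> \<open>Otherwise \<open>p d\<close> would be adjacent to every other element of the
    clique \<open>D\<close>, including some \<open>x\<close> different from \<open>d\<close>,
    against privacy.\<close>
  have p_notin: "p d \<notin> D" if "d \<in> D" for d
  proof
    assume "p d \<in> D"
    moreover obtain x where "x \<in> D" "x \<noteq> d"
      using T abc by blast
    ultimately show False
      using nonadj[of d x] D_clique[of "p d" x] that by blast
  qed
  have matched: "(d, p d) \<in> parcs G" if "d \<in> D" for d
    using p(2)[OF that] p_notin[OF that] arc_commute[of d] by (auto simp: closed_neighborhood_def)
  have p_inj: "p x \<noteq> p y" if "x \<in> D" "y \<in> D" "x \<noteq> y" for x y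
    using matched[of x] nonadj[of y x] that by auto
  \<comment> \<open>The third vertex \<open>d\<close> of \<open>T\<close> is a common non-neighbour
    of \<open>p x\<close> and \<open>p y\<close>.\<close>
  have p_clique: "(p x, p y) \<in> parcs G" if "x \<in> T" "y \<in> T" "x \<noteq> y" for x y
  proof -
    obtain d where "d \<in> T" "d \<noteq> x" "d \<noteq> y"
      using T that by blast
    with that \<open>T \<subseteq> D\<close> have "d \<in> D" "x \<in> D" "y \<in> D"
      by auto
    then show ?thesis
      by (intro no_independent_triple[OF tf, of d])
        (use nonadj[of x d] nonadj[of y d] p_inj[of x y] p(1) DV that \<open>d \<noteq> x\<close> \<open>d \<noteq> y\<close> in auto)
  qed
  let ?T' = "{p a, p b, p c}"
  have "is_triangle G T"
    using T abc DV D_clique by (auto simp: is_triangle_def)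
  moreover have "is_triangle G ?T'"
    using T abc p p_inj p_clique by (auto simp: is_triangle_def)
  moreover have "digraph_iso (with_proj G \<restriction> (T \<union> ?T')) (with_proj (complement_graph (cycle_graph 6)))"
    unfolding T(1)
  proof (rule prism_iso)
    show "distinct [a, b, c, p a, p b, p c]"
      using T abc abc[THEN p_notin] p_inj by auto
  qed (use T abc D_clique p_clique matched nonadj in auto)
  \<comment> \<open>By privacy, elements of \<open>D\<close> outside \<open>T\<close> avoid the
    closed neighbourhoods of \<open>p a\<close>, \<open>p b\<close> and \<open>p c\<close>.\<close>
  moreover have "D \<subseteq> T \<union> (pverts G - closed_neighborhood_set G ?T')"
  proof
    fix x assume "x \<in> D"
    then show "x \<in> T \<union> (pverts G - closed_neighborhood_set G ?T')"
      using p(2) abc DV T(1) by (auto simp: closed_neighborhood_set_def)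
  qed
  then have "dominating_set G (T \<union> (pverts G - closed_neighborhood_set G ?T'))"
    using dom \<open>T \<subseteq> D\<close> DV by (auto intro: dominating_set_mono)
  ultimately show False
    using prism by blast
qed

end

section \<open>The equivalence\<close>

theorem theorem14:
  fixes G :: "'a pair_pre_digraph"
  assumes "pair_graph G" and "pverts G \<noteq> {}"
  shows "(well_dominated G \<and> domination_number G = 2) \<longleftrightarrow>
    ((triangle_free (complement_graph G) \<and> (\<nexists>v. isolated_vertex (complement_graph G) v)) \<and>
     (\<forall>T T'. is_triangle G T \<and> is_triangle G T' \<and>
        digraph_iso (with_proj G \<restriction> (T \<union> T')) (with_proj (complement_graph (cycle_graph 6)))
        \<longrightarrow> \<not> dominating_set G (T \<union> (pverts G - closed_neighborhood_set G T'))))"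
proof -
  interpret pair_graph G by (rule assms)
  show ?thesis
    unfolding well_dominated_with_number_iff
  proof (intro iffI conjI allI impI notI)
    assume two: "\<forall>D. minimal_dominating_set G D \<longrightarrow> card D = 2"
    \<comment> \<open>Common source of contradiction for the triangles of the complement and for
      condition (ii): a minimal dominating set with at least three elements.\<close>
    have no_private: False
      if dom: "dominating_set G D" and "card T = 3"
        and priv: "\<And>t. t \<in> T \<Longrightarrow> \<exists>p\<in>pverts G. closed_neighborhood G p \<inter> D = {t}" for D T
    proof -
      obtain D' where D': "minimal_dominating_set G D'" "T \<subseteq> D'"
        using minimal_dominating_set_supset_if_private_neighbors[OF dom priv] by metis
      then have "finite D'" "card D' = 2"
        using two finite_dominating_set by (auto simp: minimal_dominating_set_def)
      with D' card_mono[of D' T] \<open>card T = 3\<close> show False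
        by simp
    qed
    show "triangle_free (complement_graph G)"
      unfolding triangle_free_def
    proof
      assume "\<exists>T. is_triangle (complement_graph G) T"
      then obtain T where T: "T \<subseteq> pverts G" "card T = 3"
        "\<forall>u\<in>T. \<forall>v\<in>T. (u, v) \<notin> parcs G"
        unfolding triangle_complement_graph_iff by blast
      \<comment> \<open>The added vertices are exactly those that \<open>T\<close> leaves
        undominated, and they lie outside the closed neighbourhood of every \<open>t\<close> in
        \<open>T\<close>.\<close>
      let ?D = "T \<union> (pverts G - closed_neighborhood_set G T)"
      show False
      proof (rule no_private[of ?D T])
        show "dominating_set G ?D"
          using T by (auto simp: dominating_set_def closed_neighborhood_set_def closed_neighborhood_def)
        show "\<exists>p\<in>pverts G. closed_neighborhood G p \<inter> ?D = {t}" if "t \<in> T" for t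
          using T that
          by (intro bexI[of _ t]) (auto simp: closed_neighborhood_set_def closed_neighborhood_def)
      qed (rule T)
    qed
    show False if "\<exists>v. isolated_vertex (complement_graph G) v"
    proof -
      obtain v where v: "dominating_set G {v}"
        using \<open>\<exists>v. _ v\<close> unfolding isolated_vertex_complement_graph_iff by blast
      then obtain D where "minimal_dominating_set G D" "D \<subseteq> {v}"
        by (rule minimal_dominating_subset)
      then show False
        using two card_mono[of "{v}" D] by fastforce
    qed
    show False
      if tri: "is_triangle G T \<and> is_triangle G T' \<and>
        digraph_iso (with_proj G \<restriction> (T \<union> T')) (with_proj (complement_graph (cycle_graph 6)))"
        and dom: "dominating_set G (T \<union> (pverts G - closed_neighborhood_set G T'))" for T T'
    proof (rule no_private[OF dom])
      show "card T = 3"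
        using tri by (simp add: is_triangle_def)
      fix t assume "t \<in> T"
      with tri obtain t' where t': "t' \<in> T'" "closed_neighborhood G t' \<inter> T = {t}"
        by (elim conjE) (rule prism_matching)
      moreover have "t' \<in> pverts G"
        using t' tri by (auto simp: is_triangle_def)
      \<comment> \<open>Hence \<open>t'\<close> sees no vertex of the second part of the dominating
        set, and its privacy within \<open>T\<close> extends to the whole set.\<close>
      moreover have "closed_neighborhood G t' \<subseteq> closed_neighborhood_set G T'"
        using t' by (auto simp: closed_neighborhood_set_def)
      ultimately show "\<exists>p\<in>pverts G. closed_neighborhood G p \<inter>
          (T \<union> (pverts G - closed_neighborhood_set G T')) = {t}"
        by blast
    qed
  next
    fix D
    assume rhs: "(triangle_free (complement_graph G) \<and> (\<nexists>v. isolated_vertex (complement_graph G) v)) \<and>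
     (\<forall>T T'. is_triangle G T \<and> is_triangle G T' \<and>
        digraph_iso (with_proj G \<restriction> (T \<union> T')) (with_proj (complement_graph (cycle_graph 6)))
        \<longrightarrow> \<not> dominating_set G (T \<union> (pverts G - closed_neighborhood_set G T')))"
      and D: "minimal_dominating_set G D"
    have dom: "dominating_set G D" and fin: "finite D"
      using D finite_dominating_set by (auto simp: minimal_dominating_set_def)
    have "card D \<le> 2"
      using rhs D by (intro card_minimal_dominating_set_le_2) blast+
    \<comment> \<open>The empty set dominates only the empty graph.\<close>
    moreover have "card D \<noteq> 0"
      using dom fin \<open>pverts G \<noteq> {}\<close> by (auto simp: dominating_set_def)
    moreover have "card D \<noteq> 1"
    proof
      assume "card D = 1"
      then obtain v where "D = {v}"
        by (auto simp: card_1_singleton_iff)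
      with dom rhs show False
        by (auto simp: isolated_vertex_complement_graph_iff dominating_set_def)
    qed
    ultimately show "card D = 2"
      by linarith
  qed
qed

end
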